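(* Let $M=\prod_{n\ge 2}^{\ell^\infty} M_n(\mathbb{C})$ be the von Neumann algebra of bounded sequences of matrices and $M^+$ its cone of positive elements. Every weakly paveable element of $M^+$ is paveable if and only if every element of $M^+$ is paveable.
   Context: For $n\ge 2$ let $M_n$ be the $n\times n$ complex matrices with the operator norm and $D_n\subset M_n$ the diagonal matrices. $M$ is the $\ell^\infty$-direct sum of the $M_n$, $n\ge 2$: its elements are sequences $a=\{a_n\}_{n\ge 2}$ with $a_n\in M_n$ and $\|a\|=\sup_n\|a_n\|<\infty$, with coordinatewise operations. $D\subset M$ is the subalgebra of those $a$ with $a_n\in D_n$ for all $n$. $\mathcal{P}:M\to D$ is the conditional expectation which replaces each $a_n$ by its diagonal part. Let $x_n\in M$ be the unit of $M_n$ viewed as a summand of $M$. An element $a\in M$ is compact if $\lim_{n\to\infty}\|x_na\|=0$; $K$ is the closed ideal of compact elements, and $\pi:M\to M/K$ is the quotient map (with the quotient $C^*$-norm on $M/K$). An element $x\in M$ is paveable if for every $\epsilon>0$ there exist a natural number $m$ and projections $p_1,\dots,p_m\in D$ such that $\sum_j p_j=1$ and $\|p_j(x-\mathcal{P}(x))p_j\|<\epsilon$ for all $j=1,\dots,m$. A non-compact element $x\in M^+$ is weakly paveable if there exist a natural number $m$ and projections $p_1,\dots,p_m\in D$ such that $\sum_j p_j=1$ and $\|\pi(p_j(x-\mathcal{P}(x))p_j)\|<\|\pi(x)\|$ for all $j=1,\dots,m$. *)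

theory Defs
  imports Complex_Main "HOL-Library.FuncSet" "HOL-Library.Complex_Order"
    "Jordan_Normal_Form.Schur_Decomposition"
begin

definition euclid_norm :: "complex vec \<Rightarrow> real" where
  "euclid_norm v = sqrt (\<Sum>i<dim_vec v. (cmod (v $ i))\<^sup>2)"

definition op_norm :: "complex mat \<Rightarrow> real" where
  "op_norm A = (SUP v\<in>{v \<in> carrier_vec (dim_col A). euclid_norm v \<le> 1}. euclid_norm (A *\<^sub>v v))"

text \<open>Order on complex numbers: \<open>0 \<le> z\<close> means that \<open>z\<close> is real and nonnegative, so a
  positive matrix is automatically Hermitian.\<close>

definition positive_mat :: "complex mat \<Rightarrow> bool" where
  "positive_mat A \<longleftrightarrow> square_mat A \<and> (\<forall>v\<in>carrier_vec (dim_row A). 0 \<le> (A *\<^sub>v v) \<bullet>c v)"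

definition diag_part :: "complex mat \<Rightarrow> complex mat" where
  "diag_part A = mat_diag (dim_row A) (\<lambda>i. A $$ (i, i))"


text \<open>Elements of \<open>M\<close> are families indexed by \<open>n \<ge> 2\<close>. They are extensional functions
  (\<open>undefined\<close> at indices 0 and 1), so that equality of functions is equality in \<open>M\<close>;
  hence the operations below are restricted to \<open>{2..}\<close>.\<close>

type_synonym mat_seq = "nat \<Rightarrow> complex mat"

definition M_alg :: "mat_seq set" where
  "M_alg = {a \<in> (\<Pi>\<^sub>E n\<in>{2..}. carrier_mat n n). bdd_above ((\<lambda>n. op_norm (a n)) ` {2..})}"

definition M_norm :: "mat_seq \<Rightarrow> real" where
  "M_norm a = (SUP n\<in>{2..}. op_norm (a n))"

definition M_one :: mat_seq where
  "M_one = (\<lambda>n\<in>{2..}. 1\<^sub>m n)"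

definition M_minus :: "mat_seq \<Rightarrow> mat_seq \<Rightarrow> mat_seq" where
  "M_minus a b = (\<lambda>n\<in>{2..}. a n - b n)"

definition M_mult :: "mat_seq \<Rightarrow> mat_seq \<Rightarrow> mat_seq" where
  "M_mult a b = (\<lambda>n\<in>{2..}. a n * b n)"

definition M_adj :: "mat_seq \<Rightarrow> mat_seq" where
  "M_adj a = (\<lambda>n\<in>{2..}. mat_adjoint (a n))"

text \<open>Summation is done entrywise, since the type of matrices of arbitrary dimension is not a
  commutative monoid and so \<^const>\<open>sum\<close> does not apply to it.\<close>

definition M_sum :: "nat \<Rightarrow> (nat \<Rightarrow> mat_seq) \<Rightarrow> mat_seq" where
  "M_sum m p = (\<lambda>n\<in>{2..}. mat n n (\<lambda>(i, k). \<Sum>j<m. p j n $$ (i, k)))"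

definition M_pos :: "mat_seq set" where
  "M_pos = {a \<in> M_alg. \<forall>n\<ge>2. positive_mat (a n)}"

definition D_alg :: "mat_seq set" where
  "D_alg = {a \<in> M_alg. \<forall>n\<ge>2. diagonal_mat (a n)}"

definition cond_exp :: "mat_seq \<Rightarrow> mat_seq" where
  "cond_exp a = (\<lambda>n\<in>{2..}. diag_part (a n))"

definition D_projections :: "mat_seq set" where
  "D_projections = {p \<in> D_alg. M_mult p p = p \<and> M_adj p = p}"


definition block_unit :: "nat \<Rightarrow> mat_seq" where
  "block_unit n = (\<lambda>k\<in>{2..}. if k = n then 1\<^sub>m k else 0\<^sub>m k k)"

definition compact_elements :: "mat_seq set" where
  "compact_elements = {a \<in> M_alg. (\<lambda>n. M_norm (M_mult (block_unit n) a)) \<longlonglongrightarrow> 0}"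

text \<open>The quotient \<open>M/K\<close>: its elements are the cosets of the ideal of compact elements, and the norm
  of a coset is the infimum of the norms of its representatives.\<close>

definition quot_map :: "mat_seq \<Rightarrow> mat_seq set" where
  "quot_map a = {b \<in> M_alg. M_minus b a \<in> compact_elements}"

definition quot_norm :: "mat_seq set \<Rightarrow> real" where
  "quot_norm C = (INF b\<in>C. M_norm b)"


definition compress_offdiag :: "mat_seq \<Rightarrow> mat_seq \<Rightarrow> mat_seq" where
  "compress_offdiag p x = M_mult (M_mult p (M_minus x (cond_exp x))) p"

definition paveable :: "mat_seq \<Rightarrow> bool" where
  "paveable x \<longleftrightarrow> x \<in> M_alg \<and>
     (\<forall>\<epsilon>>0. \<exists>(m::nat) p. (\<forall>j<m. p j \<in> D_projections) \<and> M_sum m p = M_one \<and>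
        (\<forall>j<m. M_norm (compress_offdiag (p j) x) < \<epsilon>))"

definition weakly_paveable :: "mat_seq \<Rightarrow> bool" where
  "weakly_paveable x \<longleftrightarrow> x \<in> M_pos \<and> x \<notin> compact_elements \<and>
     (\<exists>(m::nat) p. (\<forall>j<m. p j \<in> D_projections) \<and> M_sum m p = M_one \<and>
        (\<forall>j<m. quot_norm (quot_map (compress_offdiag (p j) x)) < quot_norm (quot_map x)))"

end

theory Submission
  imports Defs "HOL-Analysis.L2_Norm"
begin

text \<open>
  Paveability of \<open>x\<close> depends only on \<open>x - \<P>(x)\<close>, which does not change when a scalar \<open>c\<close> is
  added to \<open>x\<close>. For \<open>x \<ge> 0\<close> all diagonal entries of \<open>x + c\<close> are at least \<open>c\<close>, so
  \<open>\<parallel>\<pi>(x + c)\<parallel> \<ge> c\<close>. Taking \<open>c > \<parallel>x - \<P>(x)\<parallel>\<close>, the single projection \<open>1\<close> shows that \<open>x + c\<close> is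
  weakly paveable.
\<close>

section \<open>Euclidean norm of vectors and operator norm of matrices\<close>

lemma euclid_norm_L2_set: "euclid_norm v = L2_set (\<lambda>i. cmod (v $ i)) {..<dim_vec v}"
  by (simp add: euclid_norm_def L2_set_def)

lemma euclid_norm_zero [simp]: "euclid_norm (0\<^sub>v n) = 0"
  by (simp add: euclid_norm_def)

lemma euclid_norm_unit_vec: "i < n \<Longrightarrow> euclid_norm (unit_vec n i) = 1"
  by (simp add: euclid_norm_def unit_vec_def if_distrib[of cmod] if_distrib[of "\<lambda>x. x\<^sup>2"] cong: if_cong)

lemma cmod_index_le_euclid_norm: "i < dim_vec v \<Longrightarrow> cmod (v $ i) \<le> euclid_norm v"
  unfolding euclid_norm_L2_set by (rule member_le_L2_set) auto

lemma euclid_norm_le_sum: "euclid_norm v \<le> (\<Sum>i<dim_vec v. cmod (v $ i))"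
  unfolding euclid_norm_L2_set by (rule L2_set_le_sum) auto

lemma euclid_norm_diff_le:
  assumes "dim_vec v = dim_vec w"
  shows "euclid_norm (v - w) \<le> euclid_norm v + euclid_norm w"
proof -
  have "euclid_norm (v - w) \<le> L2_set (\<lambda>i. cmod (v $ i) + cmod (w $ i)) {..<dim_vec v}"
    using assms unfolding euclid_norm_L2_set
    by (auto intro!: L2_set_mono simp: norm_triangle_ineq4)
  also have "\<dots> \<le> euclid_norm v + euclid_norm w"
    using assms unfolding euclid_norm_L2_set by (simp add: L2_set_triangle_ineq)
  finally show ?thesis .
qed

lemma op_norm_leI:
  assumes "\<And>v. v \<in> carrier_vec (dim_col A) \<Longrightarrow> euclid_norm v \<le> 1 \<Longrightarrow> euclid_norm (A *\<^sub>v v) \<le> C"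
  shows "op_norm A \<le> C"
  unfolding op_norm_def
proof (rule cSUP_least)
  show "{v \<in> carrier_vec (dim_col A). euclid_norm v \<le> 1} \<noteq> {}"
    using zero_carrier_vec[of "dim_col A"] euclid_norm_zero by (metis (mono_tags, lifting) empty_Collect_eq zero_le_one)
qed (use assms in auto)

text \<open>A real supremum dominates its members only when the set is bounded, so lower estimates
  of \<open>op_norm\<close> rest on this. On the unit ball every coordinate of \<open>v\<close> has
  modulus at most 1, and the sum of the moduli of all entries of \<open>A\<close> is a crude but
  sufficient bound.\<close>

lemma bdd_above_op_norm:
  "bdd_above ((\<lambda>v. euclid_norm (A *\<^sub>v v)) ` {v \<in> carrier_vec (dim_col A). euclid_norm v \<le> 1})"
proof (rule bdd_aboveI2)
  fix v assume v: "v \<in> {v \<in> carrier_vec (dim_col A). euclid_norm v \<le> 1}"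
  have "cmod ((A *\<^sub>v v) $ i) \<le> (\<Sum>j<dim_col A. cmod (A $$ (i, j)))" if i: "i < dim_row A" for i
  proof -
    have "cmod (A $$ (i, j) * v $ j) \<le> cmod (A $$ (i, j))" if "j < dim_col A" for j
    proof -
      have "cmod (v $ j) \<le> 1"
        using cmod_index_le_euclid_norm[of j v] v that by auto
      then show ?thesis by (simp add: norm_mult mult_left_le)
    qed
    then show ?thesis
      using v i by (auto simp: scalar_prod_def atLeast0LessThan intro!: sum_norm_le)
  qed
  then have "(\<Sum>i<dim_row A. cmod ((A *\<^sub>v v) $ i)) \<le> (\<Sum>i<dim_row A. \<Sum>j<dim_col A. cmod (A $$ (i, j)))"
    by (intro sum_mono) auto
  then show "euclid_norm (A *\<^sub>v v) \<le> (\<Sum>i<dim_row A. \<Sum>j<dim_col A. cmod (A $$ (i, j)))"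
    using euclid_norm_le_sum[of "A *\<^sub>v v"] by simp
qed

lemma euclid_norm_mult_le_op_norm:
  assumes "v \<in> carrier_vec (dim_col A)" "euclid_norm v \<le> 1"
  shows "euclid_norm (A *\<^sub>v v) \<le> op_norm A"
  unfolding op_norm_def using assms by (intro cSUP_upper bdd_above_op_norm) auto

lemma op_norm_nonneg: "0 \<le> op_norm A"
  using euclid_norm_mult_le_op_norm[of "0\<^sub>v (dim_col A)" A]
  by (smt (verit) euclid_norm_L2_set L2_set_nonneg euclid_norm_zero zero_carrier_vec)

lemma op_norm_zero [simp]: "op_norm (0\<^sub>m n k) = 0"
proof (rule antisym)
  have "0\<^sub>m n k *\<^sub>v v = 0\<^sub>v n" if "v \<in> carrier_vec k" for v :: "complex vec"
    using that by (intro eq_vecI) auto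
  then show "op_norm (0\<^sub>m n k) \<le> 0"
    by (intro op_norm_leI) auto
qed (rule op_norm_nonneg)

text \<open>The \<open>j\<close>-th unit vector has norm 1 and is sent to column \<open>j\<close>,
  whose norm dominates each of its coordinates. This serves twice: for diagonal parts and for corner
  entries.\<close>

lemma cmod_entry_le_op_norm:
  assumes "i < dim_row A" "j < dim_col A"
  shows "cmod (A $$ (i, j)) \<le> op_norm A"
proof -
  have "cmod (A $$ (i, j)) = cmod ((A *\<^sub>v unit_vec (dim_col A) j) $ i)"
    using assms by simp
  also have "\<dots> \<le> euclid_norm (A *\<^sub>v unit_vec (dim_col A) j)"
    using assms by (intro cmod_index_le_euclid_norm) auto
  also have "\<dots> \<le> op_norm A"
    using assms by (intro euclid_norm_mult_le_op_norm) (auto simp: euclid_norm_unit_vec)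
  finally show ?thesis .
qed

lemma op_norm_diff_le:
  assumes A: "A \<in> carrier_mat n k" and B: "B \<in> carrier_mat n k"
  shows "op_norm (A - B) \<le> op_norm A + op_norm B"
proof (rule op_norm_leI)
  fix v :: "complex vec" assume v: "v \<in> carrier_vec (dim_col (A - B))" "euclid_norm v \<le> 1"
  then have "(A - B) *\<^sub>v v = A *\<^sub>v v - B *\<^sub>v v"
    using A B by (intro minus_mult_distrib_mat_vec) auto
  then have "euclid_norm ((A - B) *\<^sub>v v) \<le> euclid_norm (A *\<^sub>v v) + euclid_norm (B *\<^sub>v v)"
    using A B by (simp add: euclid_norm_diff_le)
  also have "\<dots> \<le> op_norm A + op_norm B"
    using A B v by (intro add_mono euclid_norm_mult_le_op_norm) auto
  finally show "euclid_norm ((A - B) *\<^sub>v v) \<le> op_norm A + op_norm B" .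
qed

lemma mat_diag_mult_vec:
  assumes "v \<in> carrier_vec n"
  shows "mat_diag n f *\<^sub>v v = vec n (\<lambda>i. f i * v $ i)"
proof (rule eq_vecI)
  fix i assume "i < dim_vec (vec n (\<lambda>i. f i * v $ i))"
  then have "i < n" by simp
  then show "(mat_diag n f *\<^sub>v v) $ i = vec n (\<lambda>i. f i * v $ i) $ i"
    using assms
    by (simp add: mat_diag_def scalar_prod_def if_distrib[of "\<lambda>z. z * _"] cong: if_cong)
qed (simp add: mat_diag_def)

lemma op_norm_mat_diag_le:
  assumes "\<And>i. i < n \<Longrightarrow> cmod (f i) \<le> C" and "0 \<le> C"
  shows "op_norm (mat_diag n f) \<le> C"
proof (rule op_norm_leI)
  fix v :: "complex vec" assume "v \<in> carrier_vec (dim_col (mat_diag n f))" and v1: "euclid_norm v \<le> 1"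
  then have v: "v \<in> carrier_vec n" by (simp add: mat_diag_def)
  have "euclid_norm (mat_diag n f *\<^sub>v v) \<le> L2_set (\<lambda>i. C * cmod (v $ i)) {..<n}"
    unfolding mat_diag_mult_vec[OF v] euclid_norm_L2_set
    using assms by (auto intro!: L2_set_mono simp: norm_mult mult_right_mono)
  also have "\<dots> = C * euclid_norm v"
    using v assms(2) by (simp add: L2_set_right_distrib euclid_norm_L2_set)
  also have "\<dots> \<le> C"
    using v1 assms(2) by (rule mult_left_le)
  finally show "euclid_norm (mat_diag n f *\<^sub>v v) \<le> C" .
qed

text \<open>A diagonal matrix has norm at most its largest entry in modulus, and here that entry is
  also one of \<open>A\<close>. Hence \<open>cond_exp\<close> keeps families bounded.\<close>

lemma op_norm_diag_part_le:
  assumes "A \<in> carrier_mat n n"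
  shows "op_norm (diag_part A) \<le> op_norm A"
  unfolding diag_part_def using assms
  by (intro op_norm_mat_diag_le cmod_entry_le_op_norm op_norm_nonneg) auto

section \<open>The algebra \<open>M_alg\<close>, its norm, scalars and unit\<close>

lemma M_algI:
  assumes "\<And>n. n < 2 \<Longrightarrow> a n = undefined" "\<And>n. n \<ge> 2 \<Longrightarrow> a n \<in> carrier_mat n n"
    and "\<And>n. n \<ge> 2 \<Longrightarrow> op_norm (a n) \<le> C"
  shows "a \<in> M_alg"
  using assms unfolding M_alg_def by (auto intro!: PiE_I bdd_aboveI2)

lemma M_alg_carrier: "a \<in> M_alg \<Longrightarrow> n \<ge> 2 \<Longrightarrow> a n \<in> carrier_mat n n"
  by (auto simp: M_alg_def)

lemma M_alg_undefined: "a \<in> M_alg \<Longrightarrow> n < 2 \<Longrightarrow> a n = undefined"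
  by (auto simp: M_alg_def PiE_def extensional_def)

lemma op_norm_le_M_norm: "a \<in> M_alg \<Longrightarrow> n \<ge> 2 \<Longrightarrow> op_norm (a n) \<le> M_norm a"
  unfolding M_norm_def M_alg_def by (intro cSUP_upper) auto

lemma M_norm_nonneg: "a \<in> M_alg \<Longrightarrow> 0 \<le> M_norm a"
  using op_norm_le_M_norm[of a 2] op_norm_nonneg[of "a 2"] by simp

lemma M_minus_closed:
  assumes "a \<in> M_alg" "b \<in> M_alg"
  shows "M_minus a b \<in> M_alg"
proof (rule M_algI[where C = "M_norm a + M_norm b"])
  fix n :: nat assume n: "n \<ge> 2"
  show "op_norm (M_minus a b n) \<le> M_norm a + M_norm b"
    using op_norm_diff_le[OF M_alg_carrier M_alg_carrier, OF assms(1) n assms(2) n]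
      op_norm_le_M_norm[OF assms(1) n] op_norm_le_M_norm[OF assms(2) n] n
    by (simp add: M_minus_def)
  show "M_minus a b n \<in> carrier_mat n n"
    using M_alg_carrier[OF assms(2) n] n by (auto simp: M_minus_def)
qed (simp add: M_minus_def)

lemma cond_exp_closed:
  assumes "a \<in> M_alg"
  shows "cond_exp a \<in> M_alg"
proof (rule M_algI[where C = "M_norm a"])
  fix n :: nat assume n: "n \<ge> 2"
  show "op_norm (cond_exp a n) \<le> M_norm a"
    using op_norm_diag_part_le[OF M_alg_carrier, OF assms n] op_norm_le_M_norm[OF assms n] n
    by (simp add: cond_exp_def)
  show "cond_exp a n \<in> carrier_mat n n"
    using M_alg_carrier[OF assms n] n by (auto simp: cond_exp_def diag_part_def mat_diag_def)
qed (simp add: cond_exp_def)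

text \<open>The scalar multiples of the unit. The operations on \<open>mat_seq\<close> include
  subtraction but no addition, so the translate x + c is written
  \<open>M_minus x (M_scalar (- c))\<close> below.\<close>

definition M_scalar :: "complex \<Rightarrow> mat_seq" where
  "M_scalar c = (\<lambda>n\<in>{2..}. mat_diag n (\<lambda>_. c))"

lemma M_scalar_closed: "M_scalar c \<in> M_alg"
  by (rule M_algI[where C = "cmod c"])
    (auto simp: M_scalar_def op_norm_mat_diag_le)

lemma M_one_eq: "M_one = M_scalar 1"
  by (auto simp: M_one_def M_scalar_def mat_diag_def intro!: ext eq_matI)

lemma M_mult_one_left: "a \<in> M_alg \<Longrightarrow> M_mult M_one a = a"
  using M_alg_carrier M_alg_undefined by (fastforce simp: M_mult_def M_one_def)

lemma M_mult_one_right: "a \<in> M_alg \<Longrightarrow> M_mult a M_one = a"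
  using M_alg_carrier M_alg_undefined by (fastforce simp: M_mult_def M_one_def)

lemma M_one_in_D_projections: "M_one \<in> D_projections"
proof -
  have one: "M_one \<in> M_alg"
    by (simp add: M_one_eq M_scalar_closed)
  moreover have "diagonal_mat (M_one n)" if "n \<ge> 2" for n
    using that by (simp add: M_one_def diagonal_mat_def)
  moreover have "M_adj M_one = M_one"
    by (rule ext) (auto simp: M_adj_def M_one_def mat_adjoint_def mat_of_rows_index intro!: eq_matI)
  ultimately show ?thesis
    by (simp add: D_projections_def D_alg_def M_mult_one_left)
qed

section \<open>Compact elements and the quotient norm\<close>

lemma M_norm_block_unit_mult:
  assumes "a \<in> M_alg" "n \<ge> 2"
  shows "M_norm (M_mult (block_unit n) a) = op_norm (a n)"
proof (rule antisym)
  have eq: "op_norm (M_mult (block_unit n) a k) = (if k = n then op_norm (a n) else 0)"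
    if "k \<ge> 2" for k
    using M_alg_carrier[OF assms(1) that] that by (auto simp: M_mult_def block_unit_def)
  then show "M_norm (M_mult (block_unit n) a) \<le> op_norm (a n)"
    unfolding M_norm_def by (intro cSUP_least) (auto simp: op_norm_nonneg)
  \<comment> \<open>Membership of the product in \<open>M_alg\<close> has not been established, so
    boundedness is read off from \<open>eq\<close>: only block \<open>n\<close> is nonzero.\<close>
  have "bdd_above ((\<lambda>k. op_norm (M_mult (block_unit n) a k)) ` {2..})"
    using eq by (intro bdd_aboveI2[where M = "op_norm (a n)"]) (auto simp: op_norm_nonneg)
  then have "op_norm (M_mult (block_unit n) a n) \<le> M_norm (M_mult (block_unit n) a)"
    unfolding M_norm_def using assms(2) by (intro cSUP_upper) auto
  then show "op_norm (a n) \<le> M_norm (M_mult (block_unit n) a)"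
    using eq assms(2) by simp
qed

text \<open>Multiplying by \<open>block_unit n\<close> isolates block \<open>n\<close>, so the two
  sequences agree from index 2 on. The values at 0 and 1 may differ, since \<open>a\<close> is
  \<open>undefined\<close> there, but the limit ignores them.\<close>

lemma compact_elements_iff:
  "a \<in> compact_elements \<longleftrightarrow> a \<in> M_alg \<and> (\<lambda>n. op_norm (a n)) \<longlonglongrightarrow> 0"
proof -
  have "((\<lambda>n. M_norm (M_mult (block_unit n) a)) \<longlonglongrightarrow> 0) \<longleftrightarrow> ((\<lambda>n. op_norm (a n)) \<longlonglongrightarrow> 0)"
    if "a \<in> M_alg"
    using M_norm_block_unit_mult[OF that]
    by (intro tendsto_cong eventually_sequentiallyI[of 2])
  then show ?thesis
    by (auto simp: compact_elements_def)
qed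

lemma M_minus_self_compact:
  assumes "a \<in> M_alg"
  shows "M_minus a a \<in> compact_elements"
proof -
  have "op_norm (M_minus a a n) = 0" if "n \<ge> 2" for n
    using M_alg_carrier[OF assms that] that by (simp add: M_minus_def)
  then have "(\<lambda>n. op_norm (M_minus a a n)) \<longlonglongrightarrow> 0"
    by (intro tendsto_eventually eventually_sequentiallyI[of 2])
  then show ?thesis
    using assms by (simp add: compact_elements_iff M_minus_closed)
qed

lemma self_in_quot_map: "a \<in> M_alg \<Longrightarrow> a \<in> quot_map a"
  by (simp add: quot_map_def M_minus_self_compact)

text \<open>\<open>a\<close> represents its own coset, and nonnegativity of \<open>M_norm\<close>
  bounds the infimum from below.\<close>

lemma quot_norm_le_M_norm:
  assumes "a \<in> M_alg"
  shows "quot_norm (quot_map a) \<le> M_norm a"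
  unfolding quot_norm_def
proof (rule cINF_lower)
  show "bdd_below (M_norm ` quot_map a)"
    by (rule bdd_belowI2[where m = 0]) (auto simp: quot_map_def M_norm_nonneg)
qed (simp add: self_in_quot_map assms)

text \<open>The corner \<open>(0, 0)\<close> is present in every block with index at least 2, and
  its modulus is at most the norm of the block.\<close>

lemma compact_corner_tendsto_0:
  assumes "k \<in> compact_elements"
  shows "(\<lambda>n. cmod (k n $$ (0, 0))) \<longlonglongrightarrow> 0"
proof (rule tendsto_0_le[where K = 1])
  have k: "k \<in> M_alg" "(\<lambda>n. op_norm (k n)) \<longlonglongrightarrow> 0"
    using assms by (auto simp: compact_elements_iff)
  then show "(\<lambda>n. op_norm (k n)) \<longlonglongrightarrow> 0" by simp
  show "\<forall>\<^sub>F n in sequentially. norm (cmod (k n $$ (0, 0))) \<le> norm (op_norm (k n)) * 1"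
  proof (rule eventually_sequentiallyI[of 2])
    fix n :: nat assume "n \<ge> 2"
    then show "norm (cmod (k n $$ (0, 0))) \<le> norm (op_norm (k n)) * 1"
      using M_alg_carrier[OF k(1)] cmod_entry_le_op_norm[of 0 "k n" 0] op_norm_nonneg[of "k n"]
      by fastforce
  qed
qed

text \<open>A compact perturbation moves the corner entries by a null sequence, so no representative
  of the coset can have norm below \<open>c\<close>. Watching one fixed entry avoids computing the
  quotient norm.\<close>

lemma quot_norm_ge_corner:
  assumes a: "a \<in> M_alg" and c: "\<And>n. n \<ge> 2 \<Longrightarrow> c \<le> cmod (a n $$ (0, 0))"
  shows "c \<le> quot_norm (quot_map a)"
  unfolding quot_norm_def
proof (rule cINF_greatest)
  show "quot_map a \<noteq> {}"
    using self_in_quot_map[OF a] by blast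
  fix b assume "b \<in> quot_map a"
  then have b: "b \<in> M_alg" and k: "M_minus b a \<in> compact_elements"
    by (auto simp: quot_map_def)
  have "c - cmod (M_minus b a n $$ (0, 0)) \<le> M_norm b" if n: "n \<ge> 2" for n
  proof -
    have "M_minus b a n $$ (0, 0) = b n $$ (0, 0) - a n $$ (0, 0)"
      using n M_alg_carrier[OF a n] M_alg_carrier[OF b n] by (simp add: M_minus_def)
    then have "cmod (a n $$ (0, 0)) \<le> cmod (b n $$ (0, 0)) + cmod (M_minus b a n $$ (0, 0))"
      by (metis norm_minus_commute norm_triangle_sub)
    moreover have "cmod (b n $$ (0, 0)) \<le> M_norm b"
      using n M_alg_carrier[OF b n] cmod_entry_le_op_norm[of 0 "b n" 0] op_norm_le_M_norm[OF b n]
      by auto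
    ultimately show ?thesis
      using c[OF n] by linarith
  qed
  \<comment> \<open>The perturbation disappears in the limit while \<open>M_norm b\<close> stays
    fixed.\<close>
  moreover have "(\<lambda>n. c - cmod (M_minus b a n $$ (0, 0))) \<longlonglongrightarrow> c - 0"
    by (intro tendsto_diff tendsto_const compact_corner_tendsto_0 k)
  ultimately show "c \<le> M_norm b"
    by (intro LIMSEQ_le_const2[where a = "M_norm b" and x = c]) auto
qed

text \<open>Supplies the non-compactness that \<open>weakly_paveable\<close> demands.\<close>

lemma not_compact_of_corner:
  assumes "0 < c" and "\<And>n. n \<ge> 2 \<Longrightarrow> c \<le> cmod (a n $$ (0, 0))"
  shows "a \<notin> compact_elements"
proof
  assume "a \<in> compact_elements"
  then have "c \<le> 0"
    using assms(2) by (intro LIMSEQ_le_const[OF compact_corner_tendsto_0]) auto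
  with assms(1) show False by simp
qed

section \<open>Positivity and translation by scalars\<close>

lemma positive_mat_diag_entry:
  assumes "positive_mat A" "i < dim_row A"
  shows "0 \<le> A $$ (i, i)"
proof -
  have sq: "dim_col A = dim_row A"
    using assms(1) by (simp add: positive_mat_def)
  have "0 \<le> (A *\<^sub>v unit_vec (dim_row A) i) \<bullet>c unit_vec (dim_row A) i"
    using assms(1) by (simp add: positive_mat_def)
  also have "conjugate (unit_vec (dim_row A) i) = (unit_vec (dim_row A) i :: complex vec)"
    by (rule eq_vecI) (auto simp: unit_vec_def)
  also have "(A *\<^sub>v unit_vec (dim_row A) i) \<bullet> unit_vec (dim_row A) i = A $$ (i, i)"
    using assms(2) sq by simp
  finally show ?thesis .
qed

text \<open>The translation adds \<open>c * (v \<bullet>c v)\<close> to the quadratic form. In the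
  complex order \<open>0 \<le> c\<close> makes \<open>c\<close> real, so this term is real and
  nonnegative.\<close>

lemma positive_mat_add_scalar:
  assumes "A \<in> carrier_mat n n" "positive_mat A" "0 \<le> c"
  shows "positive_mat (A - mat_diag n (\<lambda>_. - c))"
  unfolding positive_mat_def
proof (intro conjI ballI)
  fix v :: "complex vec" assume "v \<in> carrier_vec (dim_row (A - mat_diag n (\<lambda>_. - c)))"
  then have v: "v \<in> carrier_vec n" by (simp add: mat_diag_def)
  have "(A - mat_diag n (\<lambda>_. - c)) *\<^sub>v v = A *\<^sub>v v - mat_diag n (\<lambda>_. - c) *\<^sub>v v"
    using assms(1) v by (intro minus_mult_distrib_mat_vec) auto
  also have "\<dots> = A *\<^sub>v v + c \<cdot>\<^sub>v v"
    unfolding mat_diag_mult_vec[OF v] using v assms(1) by (intro eq_vecI) auto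
  finally have "((A - mat_diag n (\<lambda>_. - c)) *\<^sub>v v) \<bullet>c v = (A *\<^sub>v v) \<bullet>c v + c * (v \<bullet>c v)"
    using v assms(1) by (simp add: add_scalar_prod_distrib[of _ n])
  moreover have "0 \<le> (A *\<^sub>v v) \<bullet>c v"
    using assms(1,2) v by (simp add: positive_mat_def)
  moreover have "0 \<le> c * (v \<bullet>c v)"
    using assms(3) by (intro mult_nonneg_nonneg conjugate_square_ge_0_vec)
  ultimately show "0 \<le> ((A - mat_diag n (\<lambda>_. - c)) *\<^sub>v v) \<bullet>c v"
    by simp
qed (simp add: mat_diag_def)

text \<open>A scalar is its own diagonal part, so it cancels before any projection is
  applied.\<close>

lemma compress_offdiag_minus_scalar:
  assumes "x \<in> M_alg"
  shows "compress_offdiag p (M_minus x (M_scalar s)) = compress_offdiag p x"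
proof -
  have "M_minus (M_minus x (M_scalar s)) (cond_exp (M_minus x (M_scalar s))) = M_minus x (cond_exp x)"
  proof
    fix n
    show "M_minus (M_minus x (M_scalar s)) (cond_exp (M_minus x (M_scalar s))) n
        = M_minus x (cond_exp x) n"
    proof (cases "n \<ge> 2")
      case True
      then have "dim_row (x n) = n" "dim_col (x n) = n"
        using M_alg_carrier[OF assms] by auto
      with True show ?thesis
        by (intro eq_matI)
          (auto simp: M_minus_def M_scalar_def cond_exp_def diag_part_def mat_diag_def)
    qed (simp add: M_minus_def)
  qed
  then show ?thesis
    by (simp add: compress_offdiag_def)
qed

lemma paveable_minus_scalar:
  assumes "x \<in> M_alg"
  shows "paveable (M_minus x (M_scalar s)) \<longleftrightarrow> paveable x"
  using assms
  by (simp add: paveable_def compress_offdiag_minus_scalar M_minus_closed M_scalar_closed)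

lemma weakly_paveable_add_scalar:
  assumes x: "x \<in> M_pos" and c: "M_norm (M_minus x (cond_exp x)) < c"
  shows "weakly_paveable (M_minus x (M_scalar (- of_real c)))"
proof -
  define y where "y = M_minus x (M_scalar (- of_real c))"
  define z where "z = M_minus x (cond_exp x)"
  have xM: "x \<in> M_alg" and xpos: "\<And>n. n \<ge> 2 \<Longrightarrow> positive_mat (x n)"
    using x by (auto simp: M_pos_def)
  have z: "z \<in> M_alg"
    unfolding z_def by (intro M_minus_closed cond_exp_closed xM)
  then have "0 < c"
    using M_norm_nonneg[OF z] c by (simp add: z_def)
  have y: "y \<in> M_alg"
    unfolding y_def by (intro M_minus_closed M_scalar_closed xM)
  have "positive_mat (y n)" if n: "n \<ge> 2" for n
    using positive_mat_add_scalar[OF M_alg_carrier[OF xM n] xpos[OF n], of "of_real c"] \<open>0 < c\<close> n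
    by (simp add: y_def M_minus_def M_scalar_def less_eq_complex_def)
  then have ypos: "y \<in> M_pos"
    using y by (simp add: M_pos_def)
  have corner: "c \<le> cmod (y n $$ (0, 0))" if n: "n \<ge> 2" for n
  proof -
    have "y n $$ (0, 0) = x n $$ (0, 0) + of_real c"
      using M_alg_carrier[OF xM n] n by (simp add: y_def M_minus_def M_scalar_def mat_diag_def)
    moreover have "0 \<le> x n $$ (0, 0)"
      using positive_mat_diag_entry[OF xpos[OF n], of 0] M_alg_carrier[OF xM n] n by auto
    \<comment> \<open>The corner of \<open>x n\<close> is a nonnegative real, so it cannot cancel
      any of \<open>c\<close>.\<close>
    ultimately have "c \<le> Re (y n $$ (0, 0))"
      by (simp add: less_eq_complex_def)
    then show ?thesis
      using complex_Re_le_cmod order_trans by blast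
  qed
  \<comment> \<open>Compressing by the unit changes nothing, and the scalar drops out, leaving the
    off-diagonal part of \<open>x\<close>.\<close>
  have "compress_offdiag M_one y = z"
    unfolding y_def compress_offdiag_minus_scalar[OF xM] using z
    by (simp add: compress_offdiag_def z_def M_mult_one_left M_mult_one_right)
  \<comment> \<open>The chain is: quotient norm of \<open>z\<close> \<le> \<open>M_norm z\<close> <
    \<open>c\<close> \<le> quotient norm of \<open>y\<close>.\<close>
  then have "quot_norm (quot_map (compress_offdiag M_one y)) < quot_norm (quot_map y)"
    using quot_norm_le_M_norm[OF z] quot_norm_ge_corner[OF y corner] c by (simp add: z_def)
  moreover have "M_sum 1 (\<lambda>_. M_one) = M_one"
    by (rule ext) (auto simp: M_sum_def M_one_def intro!: eq_matI)
  ultimately show ?thesis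
    unfolding weakly_paveable_def y_def[symmetric]
    using ypos not_compact_of_corner[OF \<open>0 < c\<close> corner] M_one_in_D_projections
    by (intro conjI exI[of _ 1] exI[of _ "\<lambda>_. M_one"]) auto
qed

theorem mainTheorem4:
  shows "(\<forall>x\<in>M_pos. weakly_paveable x \<longrightarrow> paveable x) \<longleftrightarrow> (\<forall>x\<in>M_pos. paveable x)"
proof (intro iffI ballI impI)
  fix x assume wp: "\<forall>x\<in>M_pos. weakly_paveable x \<longrightarrow> paveable x" and x: "x \<in> M_pos"
  \<comment> \<open>The summand 1 makes the scalar strictly larger than the norm of the off-diagonal
    part, even when that part is zero.\<close>
  define y where "y = M_minus x (M_scalar (- of_real (M_norm (M_minus x (cond_exp x)) + 1)))"
  have "weakly_paveable y"
    unfolding y_def using x by (intro weakly_paveable_add_scalar) auto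
  then have "paveable y"
    using wp by (simp add: weakly_paveable_def)
  then show "paveable x"
    using x by (simp add: y_def paveable_minus_scalar M_pos_def del: of_real_add)
qed blast

end
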